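(* Let $\mathcal{I}$ be an ideal on $\omega$. Then $\mathrm{diam}(\mathrm{SL}(\mathcal{I}))=2$ if and only if $\mathcal{I}$ is not maximal, where $\mathrm{diam}(\mathrm{SL}(\mathcal{I})):=\sup\{\|f-g\|:f,g\in\mathrm{SL}(\mathcal{I})\}$ and $\|\cdot\|$ is the dual norm on $\ell_\infty^{\,\prime}$.
   Context: $\omega$ is the set of nonnegative integers. An ideal on $\omega$ is a family $\mathcal{I}\subseteq\mathcal{P}(\omega)$ closed under finite unions and subsets, with $\omega\notin\mathcal{I}$ and containing all finite subsets of $\omega$; it is maximal if it is maximal with respect to inclusion among such families (equivalently, for every $A\subseteq\omega$, $A\in\mathcal{I}$ or $\omega\setminus A\in\mathcal{I}$). $\ell_\infty$ is the Banach lattice of bounded real sequences with the supremum norm and pointwise order, $\ell_\infty^{\,\prime}$ its norm dual; $c$ is the space of convergent real sequences; $\bm{1}_A$ is the characteristic sequence of $A\subseteq\omega$. $\mathrm{SL}(\mathcal{I})$ is the set of linear functionals $f:\ell_\infty\to\mathbf{R}$ such that: (i) $f(x)\ge 0$ whenever $x\ge 0$; (ii) $f(x)=\lim x$ for all $x\in c$; (iii) $f(\bm{1}_A)=0$ for all $A\in\mathcal{I}$. (Such functionals are automatically continuous.) *)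

theory Defs
  imports "HOL-Analysis.Analysis"
begin

definition ideal_on_omega :: "nat set set \<Rightarrow> bool" where
  "ideal_on_omega I \<longleftrightarrow>
     (\<forall>A\<in>I. \<forall>B\<in>I. A \<union> B \<in> I) \<and>
     (\<forall>A\<in>I. \<forall>B. B \<subseteq> A \<longrightarrow> B \<in> I) \<and>
     UNIV \<notin> I \<and>
     (\<forall>A. finite A \<longrightarrow> A \<in> I)"

definition maximal_ideal_on_omega :: "nat set set \<Rightarrow> bool" where
  "maximal_ideal_on_omega I \<longleftrightarrow>
     ideal_on_omega I \<and> (\<forall>J. ideal_on_omega J \<longrightarrow> I \<subseteq> J \<longrightarrow> J = I)"

text \<open>Since \<^typ>\<open>nat\<close> is discrete, its bounded continuous real functions are exactly the bounded
  real sequences, and the library's norm on them is the supremum norm.\<close>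

type_synonym linfty = "nat \<Rightarrow>\<^sub>C real"

definition char_seq :: "nat set \<Rightarrow> linfty" where
  "char_seq A = Bcontfun (indicator A)"

lemma apply_char_seq: "apply_bcontfun (char_seq A) = indicator A"
proof -
  have "(indicator A :: nat \<Rightarrow> real) \<in> bcontfun"
    by (rule bcontfun_normI[where b = 1])
      (auto simp: indicator_def continuous_on_def at_discrete)
  then show ?thesis
    by (simp add: char_seq_def Bcontfun_inverse)
qed

definition SL :: "nat set set \<Rightarrow> (linfty \<Rightarrow> real) set" where
  "SL I = {f. linear f \<and>
     (\<forall>x. (\<forall>n. 0 \<le> apply_bcontfun x n) \<longrightarrow> 0 \<le> f x) \<and>
     (\<forall>x. convergent (apply_bcontfun x) \<longrightarrow> f x = lim (apply_bcontfun x)) \<and>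
     (\<forall>A\<in>I. f (char_seq A) = 0)}"

text \<open>The same functionals as elements of the normed dual, whose norm is the operator norm.
  The lemmas below show that passing to the dual loses none of them.\<close>

definition SL_dual :: "nat set set \<Rightarrow> (linfty \<Rightarrow>\<^sub>L real) set" where
  "SL_dual I = {F. blinfun_apply F \<in> SL I}"

lemma SL_bounded_linear:
  assumes "f \<in> SL I"
  shows "bounded_linear f"
proof -
  have lin: "linear f"
    and pos: "\<And>x. (\<And>n. 0 \<le> apply_bcontfun x n) \<Longrightarrow> 0 \<le> f x"
    and lim: "\<And>x. convergent (apply_bcontfun x) \<Longrightarrow> f x = lim (apply_bcontfun x)"
    using assms by (auto simp: SL_def)
  have const: "f (const_bcontfun c) = c" for c :: real
    using lim[of "const_bcontfun c"] by (simp add: const_bcontfun.rep_eq convergent_const)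
  have "norm (f x) \<le> norm x * 1" for x
  proof -
    have b: "\<bar>apply_bcontfun x n\<bar> \<le> norm x" for n
      using norm_bounded[of x n] by simp
    have "0 \<le> f (const_bcontfun (norm x) - x)"
    proof (rule pos)
      show "0 \<le> apply_bcontfun (const_bcontfun (norm x) - x) n" for n
        using b[of n] by (simp add: minus_bcontfun.rep_eq const_bcontfun.rep_eq)
    qed
    moreover have "0 \<le> f (const_bcontfun (norm x) + x)"
    proof (rule pos)
      show "0 \<le> apply_bcontfun (const_bcontfun (norm x) + x) n" for n
        using b[of n] by (simp add: plus_bcontfun.rep_eq const_bcontfun.rep_eq)
    qed
    ultimately show ?thesis
      by (simp add: linear_diff[OF lin] linear_add[OF lin] const)
  qed
  then show ?thesis
    using lin by (intro bounded_linear.intro bounded_linear_axioms.intro exI[of _ 1]) auto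
qed

lemma blinfun_apply_image_SL_dual: "blinfun_apply ` SL_dual I = SL I"
proof
  show "blinfun_apply ` SL_dual I \<subseteq> SL I"
    by (auto simp: SL_dual_def)
  show "SL I \<subseteq> blinfun_apply ` SL_dual I"
  proof
    fix f assume f: "f \<in> SL I"
    then have "blinfun_apply (Blinfun f) = f"
      by (simp add: SL_bounded_linear bounded_linear_Blinfun_apply)
    with f show "f \<in> blinfun_apply ` SL_dual I"
      by (auto simp: SL_dual_def intro!: image_eqI[of _ _ "Blinfun f"])
  qed
qed

end

theory Submission
  imports Defs
begin

text \<open>
  Positivity and the values on constants show that a functional \<open>f\<close> in \<^term>\<open>SL I\<close> satisfies
  \<open>f x \<le> c\<close> as soon as \<open>x n \<le> c\<close> for all \<open>n\<close> outside some set of \<open>I\<close> (lemma \<open>SL_le\<close>).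
  Taking the exceptional set empty, \<open>f\<close> has norm at most 1, so the diameter is at most 2 for
  every ideal.

  If \<open>I\<close> is maximal, every level set of a bounded sequence \<open>x\<close> lies in \<open>I\<close> or has its complement
  in \<open>I\<close>, so any threshold \<open>c\<close> bounds either all functionals in \<^term>\<open>SL I\<close> at \<open>x\<close> from above or
  all of them from below.  Two of them therefore cannot be separated, and the diameter is 0
  (lemma \<open>SL_maximal_unique\<close>).

  If \<open>I\<close> is not maximal, there is a set \<open>A\<close> such that neither \<open>A\<close> nor its complement is in \<open>I\<close>.
  Zorn's lemma gives a maximal ideal containing \<open>I\<close> and \<open>- A\<close>; the limit along the dual
  ultrafilter is a functional in \<^term>\<open>SL I\<close> that takes the value 1 at the characteristic sequence
  of \<open>A\<close> (lemma \<open>SL_attains_one\<close>).  Exchanging \<open>A\<close> and \<open>- A\<close> gives a second functional, and the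
  two take the values 1 and -1 at the norm-one sequence that is 1 on \<open>A\<close> and -1 off \<open>A\<close>.
  Hence their distance is exactly 2.
\<close>

section \<open>Ideals and maximal ideals\<close>

lemma ideal_on_omegaD:
  assumes "ideal_on_omega I"
  shows ideal_Un: "A \<in> I \<Longrightarrow> B \<in> I \<Longrightarrow> A \<union> B \<in> I"
    and ideal_subset: "A \<in> I \<Longrightarrow> B \<subseteq> A \<Longrightarrow> B \<in> I"
    and ideal_UNIV: "UNIV \<notin> I"
    and ideal_finite: "finite A \<Longrightarrow> A \<in> I"
  using assms unfolding ideal_on_omega_def by blast+

lemma ideal_Compl_notin:
  assumes "ideal_on_omega I" "A \<in> I"
  shows "- A \<notin> I"
  using ideal_Un[OF assms(1,2), of "- A"] ideal_UNIV[OF assms(1)] by auto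

text \<open>The new ideal consists of the sets that are contained in \<open>A\<close> up to a set of \<open>I\<close>; it is
  proper precisely because \<open>- A\<close> is not in \<open>I\<close>.\<close>

lemma ideal_adjoin:
  assumes I: "ideal_on_omega I" and A: "- A \<notin> I"
  obtains J where "ideal_on_omega J" "I \<subseteq> J" "A \<in> J"
proof
  let ?J = "{B. B - A \<in> I}"
  show "I \<subseteq> ?J" "A \<in> ?J"
    using ideal_subset[OF I] ideal_finite[OF I, of "{}"] by auto
  show "ideal_on_omega ?J"
    unfolding ideal_on_omega_def
  proof (intro conjI ballI allI impI)
    show "B \<union> C \<in> ?J" if "B \<in> ?J" "C \<in> ?J" for B C
      using that ideal_Un[OF I, of "B - A" "C - A"] by (simp add: Un_Diff)
    show "C \<in> ?J" if "B \<in> ?J" "C \<subseteq> B" for B C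
      using that ideal_subset[OF I, of "B - A" "C - A"] by blast
    show "UNIV \<notin> ?J"
      using A by (simp add: Compl_eq_Diff_UNIV)
    show "B \<in> ?J" if "finite B" for B
      using that ideal_finite[OF I, of "B - A"] by simp
  qed
qed

lemma maximal_ideal_dichotomy:
  assumes "maximal_ideal_on_omega I"
  shows "A \<in> I \<or> - A \<in> I"
  using assms ideal_adjoin[of I A] unfolding maximal_ideal_on_omega_def by metis

lemma not_maximal_splitting_set:
  assumes "ideal_on_omega I" "\<not> maximal_ideal_on_omega I"
  obtains A where "A \<notin> I" "- A \<notin> I"
proof -
  obtain J where J: "ideal_on_omega J" "I \<subseteq> J" "J \<noteq> I"
    using assms unfolding maximal_ideal_on_omega_def by auto
  then obtain A where "A \<in> J" "A \<notin> I" by auto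
  with J ideal_Compl_notin[OF J(1)] show ?thesis by (intro that[of A]) auto
qed

lemma maximal_ideal_extension:
  assumes I: "ideal_on_omega I"
  obtains M where "maximal_ideal_on_omega M" "I \<subseteq> M"
proof -
  let ?S = "{J. ideal_on_omega J \<and> I \<subseteq> J}"
  have "\<exists>M\<in>?S. \<forall>J\<in>?S. M \<subseteq> J \<longrightarrow> J = M"
  proof (rule subset_Zorn_nonempty)
    show "?S \<noteq> {}" using I by auto
  next
    fix \<C> assume ne: "\<C> \<noteq> {}" and ch: "subset.chain ?S \<C>"
    have C: "ideal_on_omega J" "I \<subseteq> J" if "J \<in> \<C>" for J
      using ch that by (auto simp: subset_chain_def)
    have "ideal_on_omega (\<Union>\<C>)"
      unfolding ideal_on_omega_def
    proof (intro conjI ballI allI impI)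
      fix A B assume "A \<in> \<Union>\<C>" "B \<in> \<Union>\<C>"
      then obtain J K where JK: "J \<in> \<C>" "K \<in> \<C>" "A \<in> J" "B \<in> K" by blast
      moreover have "J \<subseteq> K \<or> K \<subseteq> J"
        using ch JK by (auto simp: subset_chain_def)
      ultimately show "A \<union> B \<in> \<Union>\<C>"
        using ideal_Un[OF C(1)] by (meson UnionI subsetD)
    next
      show "B \<in> \<Union>\<C>" if "A \<in> \<Union>\<C>" "B \<subseteq> A" for A B
        using that ideal_subset[OF C(1)] by blast
      show "UNIV \<notin> \<Union>\<C>"
        using ideal_UNIV[OF C(1)] by blast
      show "A \<in> \<Union>\<C>" if "finite A" for A
        using that ne ideal_finite[OF C(1)] by blast
    qed
    with ne C(2) show "\<Union>\<C> \<in> ?S" by blast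
  qed
  then obtain M where M: "ideal_on_omega M" "I \<subseteq> M"
    and max: "\<And>J. ideal_on_omega J \<Longrightarrow> I \<subseteq> J \<Longrightarrow> M \<subseteq> J \<Longrightarrow> J = M"
    by auto
  then have "maximal_ideal_on_omega M"
    unfolding maximal_ideal_on_omega_def by blast
  with M show ?thesis by (intro that)
qed

section \<open>Order estimates for the functionals\<close>

lemma SL_D:
  assumes "f \<in> SL I"
  shows SL_linear: "linear f"
    and SL_nonneg: "(\<And>n. 0 \<le> apply_bcontfun x n) \<Longrightarrow> 0 \<le> f x"
    and SL_const: "f (const_bcontfun c) = c"
    and SL_ideal: "A \<in> I \<Longrightarrow> f (char_seq A) = 0"
  using assms by (auto simp: SL_def const_bcontfun.rep_eq convergent_const)

text \<open>On the exceptional set the sequence exceeds \<open>c\<close> by a bounded amount only, so there it is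
  absorbed by a multiple of the characteristic sequence, which \<open>f\<close> annihilates.\<close>

lemma SL_le:
  assumes f: "f \<in> SL I" and A: "A \<in> I"
    and le: "\<And>n. n \<notin> A \<Longrightarrow> apply_bcontfun x n \<le> c"
  shows "f x \<le> c"
proof -
  let ?K = "norm x + \<bar>c\<bar>"
  let ?y = "const_bcontfun c - x + ?K *\<^sub>R char_seq A"
  have "0 \<le> f ?y"
  proof (rule SL_nonneg[OF f])
    fix n
    have "\<bar>apply_bcontfun x n\<bar> \<le> norm x"
      using norm_bounded[of x n] by simp
    then show "0 \<le> apply_bcontfun ?y n"
      using le[of n]
      by (auto simp: plus_bcontfun.rep_eq minus_bcontfun.rep_eq scaleR_bcontfun.rep_eq
          const_bcontfun.rep_eq apply_char_seq indicator_def)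
  qed
  also have "f ?y = c - f x"
    by (simp add: linear_add[OF SL_linear[OF f]] linear_diff[OF SL_linear[OF f]]
        linear_scale[OF SL_linear[OF f]] SL_const[OF f] SL_ideal[OF f A])
  finally show ?thesis by simp
qed

lemma SL_ge:
  assumes f: "f \<in> SL I" and A: "A \<in> I"
    and ge: "\<And>n. n \<notin> A \<Longrightarrow> c \<le> apply_bcontfun x n"
  shows "c \<le> f x"
  using SL_le[OF f A, of "- x" "- c"] ge
  by (simp add: uminus_bcontfun.rep_eq linear_neg[OF SL_linear[OF f]])

lemma SL_dual_norm_le_1:
  assumes I: "ideal_on_omega I" and F: "F \<in> SL_dual I"
  shows "norm F \<le> 1"
proof (rule norm_blinfun_bound)
  fix x :: linfty
  have f: "blinfun_apply F \<in> SL I" using F by (simp add: SL_dual_def)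
  have b: "\<bar>apply_bcontfun x n\<bar> \<le> norm x" for n
    using norm_bounded[of x n] by simp
  have "blinfun_apply F x \<le> norm x" "- norm x \<le> blinfun_apply F x"
    using b by (auto intro!: SL_le[OF f ideal_finite[OF I, of "{}"]]
        SL_ge[OF f ideal_finite[OF I, of "{}"]] simp: abs_le_iff minus_le_iff)
  then show "norm (blinfun_apply F x) \<le> 1 * norm x" by auto
qed simp

text \<open>A threshold strictly between \<open>f x\<close> and \<open>g x\<close> would bound both values on the same side.\<close>

lemma SL_maximal_unique:
  assumes I: "maximal_ideal_on_omega I" and f: "f \<in> SL I" and g: "g \<in> SL I"
  shows "f = g"
proof -
  have *: "f x \<le> g x" if f: "f \<in> SL I" and g: "g \<in> SL I" for f g x
  proof (rule dense_ge)
    fix c assume c: "g x < c"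
    let ?A = "{n. c < apply_bcontfun x n}"
    have "?A \<in> I"
    proof (rule ccontr)
      assume "?A \<notin> I"
      with maximal_ideal_dichotomy[OF I] have "- ?A \<in> I" by blast
      then have "c \<le> g x" by (rule SL_ge[OF g]) auto
      with c show False by simp
    qed
    then show "f x \<le> c" by (rule SL_le[OF f]) auto
  qed
  show ?thesis
    using *[OF f g] *[OF g f] by (intro ext antisym)
qed

section \<open>Limits along the dual ultrafilter\<close>

definition dual_filter :: "nat set set \<Rightarrow> nat filter" where
  "dual_filter M = Abs_filter (\<lambda>P. {n. \<not> P n} \<in> M)"

lemma eventually_dual_filter:
  assumes "ideal_on_omega M"
  shows "eventually P (dual_filter M) \<longleftrightarrow> {n. \<not> P n} \<in> M"
  unfolding dual_filter_def
proof (rule eventually_Abs_filter, unfold_locales)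
  show "{n. \<not> True} \<in> M"
    using ideal_finite[OF assms] by simp
  show "{n. \<not> (P n \<and> Q n)} \<in> M" if "{n. \<not> P n} \<in> M" "{n. \<not> Q n} \<in> M" for P Q
    using ideal_Un[OF assms that] by (rule ideal_subset[OF assms]) auto
  show "{n. \<not> Q n} \<in> M" if "\<forall>n. P n \<longrightarrow> Q n" "{n. \<not> P n} \<in> M" for P Q
    using that(2) by (rule ideal_subset[OF assms]) (use that(1) in auto)
qed

lemma dual_filter_neq_bot:
  assumes "ideal_on_omega M"
  shows "dual_filter M \<noteq> bot"
  using ideal_UNIV[OF assms]
  by (auto simp: eventually_dual_filter[OF assms] trivial_limit_def)

lemma dual_filter_le_sequentially:
  assumes "ideal_on_omega M"
  shows "dual_filter M \<le> sequentially"
proof (rule filter_leI)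
  fix P assume "eventually P sequentially"
  then have "finite {n. \<not> P n}"
    by (simp flip: cofinite_eq_sequentially add: eventually_cofinite)
  then show "eventually P (dual_filter M)"
    by (simp add: eventually_dual_filter[OF assms] ideal_finite[OF assms])
qed

text \<open>Compactness of an interval containing the values gives a cluster point along the filter;
  along an ultrafilter a cluster point is a limit, since a neighbourhood that is not eventually
  visited would eventually be avoided.\<close>

lemma tendsto_dual_filter_exists:
  assumes M: "maximal_ideal_on_omega M"
  obtains l where "(apply_bcontfun (x :: linfty) \<longlongrightarrow> l) (dual_filter M)"
proof -
  let ?U = "dual_filter M" and ?K = "cball (0::real) (norm x)"
  have I: "ideal_on_omega M" using M by (simp add: maximal_ideal_on_omega_def)
  have "filtermap (apply_bcontfun x) ?U \<noteq> bot"
    using dual_filter_neq_bot[OF I] by (simp add: filtermap_bot_iff)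
  moreover have "eventually (\<lambda>y. y \<in> ?K) (filtermap (apply_bcontfun x) ?U)"
    using norm_bounded[of x] by (simp add: eventually_filtermap)
  ultimately obtain l
    where l: "inf (nhds l) (filtermap (apply_bcontfun x) ?U) \<noteq> bot"
    using compact_cball[of "0::real" "norm x"] unfolding compact_filter by blast
  have "(apply_bcontfun x \<longlongrightarrow> l) ?U"
  proof (rule topological_tendstoI)
    fix S assume S: "open S" "l \<in> S"
    show "\<forall>\<^sub>F n in ?U. apply_bcontfun x n \<in> S"
    proof (rule ccontr)
      assume "\<not> (\<forall>\<^sub>F n in ?U. apply_bcontfun x n \<in> S)"
      then have "\<forall>\<^sub>F n in ?U. apply_bcontfun x n \<notin> S"
        using maximal_ideal_dichotomy[OF M, of "{n. apply_bcontfun x n \<in> S}"]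
        by (auto simp: eventually_dual_filter[OF I] Collect_neg_eq)
      then have "\<forall>\<^sub>F y in filtermap (apply_bcontfun x) ?U. y \<notin> S"
        by (simp add: eventually_filtermap)
      moreover have "\<forall>\<^sub>F y in nhds l. y \<in> S"
        using S by (rule eventually_nhds_in_open)
      ultimately have "\<forall>\<^sub>F y in inf (nhds l) (filtermap (apply_bcontfun x) ?U). False"
        unfolding eventually_inf by blast
      with l show False by (simp add: trivial_limit_def)
    qed
  qed
  then show ?thesis by (rule that)
qed

lemma Lim_dual_filter_in_SL:
  assumes M: "maximal_ideal_on_omega M"
  shows "(\<lambda>x. Lim (dual_filter M) (apply_bcontfun x)) \<in> SL M" (is "?f \<in> _")
proof -
  let ?U = "dual_filter M"
  have I: "ideal_on_omega M" using M by (simp add: maximal_ideal_on_omega_def)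
  note nb = dual_filter_neq_bot[OF I]
  have lim: "(apply_bcontfun x \<longlongrightarrow> ?f x) ?U" for x
    by (metis tendsto_dual_filter_exists[OF M] tendsto_Lim[OF nb])
  have eq: "?f x = l" if "(apply_bcontfun x \<longlongrightarrow> l) ?U" for x l
    using nb that by (rule tendsto_Lim)
  have "linear ?f"
  proof (rule linearI)
    show "?f (x + y) = ?f x + ?f y" for x y
      using tendsto_add[OF lim[of x] lim[of y]]
      by (intro eq) (simp add: plus_bcontfun.rep_eq)
    show "?f (r *\<^sub>R x) = r *\<^sub>R ?f x" for r x
      using tendsto_scaleR[OF tendsto_const lim[of x], of r]
      by (intro eq) (simp add: scaleR_bcontfun.rep_eq)
  qed
  moreover have "0 \<le> ?f x" if "\<forall>n. 0 \<le> apply_bcontfun x n" for x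
    using lim[of x] by (rule tendsto_lowerbound) (use that nb in auto)
  moreover have "?f x = lim (apply_bcontfun x)" if "convergent (apply_bcontfun x)" for x
    using that dual_filter_le_sequentially[OF I]
    by (intro eq) (auto simp: convergent_LIMSEQ_iff intro: tendsto_mono)
  moreover have "?f (char_seq A) = 0" if "A \<in> M" for A
    using that by (intro eq tendsto_eventually)
      (simp add: apply_char_seq eventually_dual_filter[OF I] indicator_def)
  ultimately show ?thesis by (simp add: SL_def)
qed

lemma SL_antimono: "I \<subseteq> J \<Longrightarrow> SL J \<subseteq> SL I"
  by (auto simp: SL_def)

lemma SL_char_seq_Compl:
  assumes "f \<in> SL I"
  shows "f (char_seq (- A)) = 1 - f (char_seq A)"
proof -
  have "char_seq (- A) = const_bcontfun 1 - char_seq A"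
    by (rule bcontfun_eqI)
      (simp add: apply_char_seq minus_bcontfun.rep_eq const_bcontfun.rep_eq indicator_compl)
  then show ?thesis
    by (simp add: linear_diff[OF SL_linear[OF assms]] SL_const[OF assms])
qed

lemma SL_attains_one:
  assumes I: "ideal_on_omega I" and A: "A \<notin> I"
  obtains f where "f \<in> SL I" "f (char_seq A) = 1" "f (char_seq (- A)) = 0"
proof -
  obtain J where J: "ideal_on_omega J" "I \<subseteq> J" "- A \<in> J"
    using ideal_adjoin[OF I, of "- A"] A by auto
  obtain M where M: "maximal_ideal_on_omega M" "J \<subseteq> M"
    using maximal_ideal_extension[OF J(1)] .
  obtain f where f: "f \<in> SL M"
    using Lim_dual_filter_in_SL[OF M(1)] by blast
  have "f (char_seq (- A)) = 0"
    using SL_ideal[OF f] J M by blast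
  moreover from this have "f (char_seq A) = 1"
    using SL_char_seq_Compl[OF f, of A] by simp
  moreover have "f \<in> SL I"
    using f J M SL_antimono[of I M] by auto
  ultimately show ?thesis by (intro that)
qed

section \<open>The diameter\<close>

lemma diameter_SL_dual_maximal:
  assumes "maximal_ideal_on_omega I"
  shows "diameter (SL_dual I) = 0"
proof -
  have "F = G" if "F \<in> SL_dual I" "G \<in> SL_dual I" for F G
    using SL_maximal_unique[OF assms, of "blinfun_apply F" "blinfun_apply G"] that
    by (simp add: SL_dual_def blinfun_apply_inject)
  then have "SL_dual I = {} \<or> (\<exists>F. SL_dual I = {F})" by blast
  then show ?thesis by auto
qed

lemma SL_dual_dist_le_2:
  assumes "ideal_on_omega I" "F \<in> SL_dual I" "G \<in> SL_dual I"
  shows "norm (F - G) \<le> 2"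
  using norm_triangle_ineq4[of F G] SL_dual_norm_le_1[OF assms(1,2)]
    SL_dual_norm_le_1[OF assms(1,3)] by simp

lemma diameter_SL_dual_splitting_set:
  assumes I: "ideal_on_omega I" and A: "A \<notin> I" "- A \<notin> I"
  shows "diameter (SL_dual I) = 2"
proof (rule antisym)
  show "diameter (SL_dual I) \<le> 2"
    using SL_dual_dist_le_2[OF I] by (intro diameter_le) auto
next
  obtain f where f: "f \<in> SL I" "f (char_seq A) = 1" "f (char_seq (- A)) = 0"
    using SL_attains_one[OF I A(1)] .
  obtain g where g: "g \<in> SL I" "g (char_seq (- A)) = 1" "g (char_seq A) = 0"
    using SL_attains_one[OF I A(2)] by auto
  obtain F where F: "F \<in> SL_dual I" "blinfun_apply F = f"
    using f(1) unfolding blinfun_apply_image_SL_dual[symmetric] by blast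
  obtain G where G: "G \<in> SL_dual I" "blinfun_apply G = g"
    using g(1) unfolding blinfun_apply_image_SL_dual[symmetric] by blast
  let ?x = "char_seq A - char_seq (- A)"
  have "norm ?x \<le> 1"
    by (rule norm_bound)
      (simp add: minus_bcontfun.rep_eq apply_char_seq indicator_def)
  have "f ?x = 1" "g ?x = - 1"
    using f g by (simp_all add: linear_diff[OF SL_linear])
  then have "2 = norm (blinfun_apply (F - G) ?x)"
    by (simp add: minus_blinfun.rep_eq F G)
  also have "\<dots> \<le> norm (F - G) * norm ?x"
    by (rule norm_blinfun)
  also have "\<dots> \<le> dist F G"
    using mult_left_mono[OF \<open>norm ?x \<le> 1\<close>, of "norm (F - G)"] by (simp add: dist_norm)
  also have "\<dots> \<le> diameter (SL_dual I)"
  proof (rule diameter_bounded_bound)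
    show "bounded (SL_dual I)"
      using SL_dual_norm_le_1[OF I] by (auto simp: bounded_iff)
  qed (use F G in auto)
  finally show "2 \<le> diameter (SL_dual I)" .
qed

theorem theorem2p3:
  fixes I :: "nat set set"
  assumes "ideal_on_omega I"
  shows "diameter (SL_dual I) = 2 \<longleftrightarrow> \<not> maximal_ideal_on_omega I"
proof
  show "\<not> maximal_ideal_on_omega I" if "diameter (SL_dual I) = 2"
    using that diameter_SL_dual_maximal[of I] by auto
  show "diameter (SL_dual I) = 2" if not_max: "\<not> maximal_ideal_on_omega I"
  proof -
    obtain A where "A \<notin> I" "- A \<notin> I"
      using not_maximal_splitting_set[OF assms not_max] .
    then show ?thesis
      by (rule diameter_SL_dual_splitting_set[OF assms])
  qed
qed

end
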